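(* Let $w\in F_k$ be a positive word of length $\ell \ge 1$. Then for all $n\in\mathbb{N}$ (with $n \ge 1$) we have $$P_{S_n}(w)\le \left(\frac{2\ell}{n}\right)^{\lfloor \frac{n}{2\ell}\rfloor}\le (n!)^{-\frac{1}{2\ell}+o_n(1)},$$ where $o_n(1)$ denotes a quantity which, for fixed $\ell$, tends to $0$ as $n\to\infty$.
   Context: $F_k$ is the free group on $x_1,\dots,x_k$. A word $w\in F_k$ is positive (or a semigroup word) if it does not involve inverses of the generators $x_1,\dots,x_k$. For a finite group $G$ and $w\in F_k$, $P_G(w)$ is the probability that $w(g_1,\dots,g_k)=1$ when $g_1,\dots,g_k$ are chosen independently and uniformly at random from $G$, i.e. $P_G(w)=|\{(g_1,\dots,g_k)\in G^k : w(g_1,\dots,g_k)=1\}|/|G|^k$. $S_n$ is the symmetric group of degree $n$. *)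

theory Defs
  imports "HOL-Algebra.Sym_Groups" "HOL-Library.FuncSet" Complex_Main
begin

text \<open>
  The free group on \<open>x\<^sub>1, \<dots>, x\<^sub>k\<close> is realised by reduced words; \<open>Gen i\<close> stands for \<open>x\<^sub>i\<close>
  and \<open>Inv i\<close> for its inverse. Elements are their own reduced forms, so the length of a group
  element is the length of the list.
\<close>

datatype letter = Gen nat | Inv nat

primrec letter_index :: "letter \<Rightarrow> nat" where
  "letter_index (Gen i) = i"
| "letter_index (Inv i) = i"

primrec letter_inv :: "letter \<Rightarrow> letter" where
  "letter_inv (Gen i) = Inv i"
| "letter_inv (Inv i) = Gen i"

fun reduced :: "letter list \<Rightarrow> bool" where
  "reduced (a # b # w) \<longleftrightarrow> b \<noteq> letter_inv a \<and> reduced (b # w)"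
| "reduced _ \<longleftrightarrow> True"

fun reduce_Cons :: "letter \<Rightarrow> letter list \<Rightarrow> letter list" where
  "reduce_Cons a [] = [a]"
| "reduce_Cons a (b # w) = (if b = letter_inv a then w else a # b # w)"

definition free_group :: "nat \<Rightarrow> letter list monoid" where
  "free_group k =
     \<lparr>carrier = {w. reduced w \<and> letter_index ` set w \<subseteq> {1..k}},
      mult = foldr reduce_Cons,
      one = []\<rparr>"

definition positive_word :: "letter list \<Rightarrow> bool" where
  "positive_word w \<longleftrightarrow> (\<forall>i. Inv i \<notin> set w)"

primrec letter_eval :: "('a, 'b) monoid_scheme \<Rightarrow> (nat \<Rightarrow> 'a) \<Rightarrow> letter \<Rightarrow> 'a" where
  "letter_eval G g (Gen i) = g i"
| "letter_eval G g (Inv i) = inv\<^bsub>G\<^esub> (g i)"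

primrec word_eval :: "('a, 'b) monoid_scheme \<Rightarrow> (nat \<Rightarrow> 'a) \<Rightarrow> letter list \<Rightarrow> 'a" where
  "word_eval G g [] = \<one>\<^bsub>G\<^esub>"
| "word_eval G g (a # w) = letter_eval G g a \<otimes>\<^bsub>G\<^esub> word_eval G g w"

text \<open>
  Tuples in \<open>G\<^sup>k\<close> are extensional functions on \<open>{1..k}\<close>, so that there are exactly
  \<open>order G ^ k\<close> of them.
\<close>

definition word_prob :: "('a, 'b) monoid_scheme \<Rightarrow> nat \<Rightarrow> letter list \<Rightarrow> real" where
  "word_prob G k w =
     real (card {g \<in> {1..k} \<rightarrow>\<^sub>E carrier G. word_eval G g w = \<one>\<^bsub>G\<^esub>}) / real (order G) ^ k"

text \<open>
  \<open>free_group k\<close> is a group, and evaluation at \<open>g\<close> is the homomorphism sending \<open>x\<^sub>i\<close> to \<open>g i\<close>.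
\<close>

lemma letter_inv_inv [simp]: "letter_inv (letter_inv a) = a"
  by (cases a) auto

lemma letter_index_inv [simp]: "letter_index (letter_inv a) = letter_index a"
  by (cases a) auto

lemma letter_inv_neq [simp]: "letter_inv a \<noteq> a" "a \<noteq> letter_inv a"
  by (cases a; simp)+

lemma reduced_ConsD: "reduced (a # w) \<Longrightarrow> reduced w"
  by (cases w) auto

lemma reduced_reduce_Cons: "reduced w \<Longrightarrow> reduced (reduce_Cons a w)"
  by (cases w) (auto dest: reduced_ConsD)

lemma set_reduce_Cons: "set (reduce_Cons a w) \<subseteq> insert a (set w)"
  by (cases w) auto

lemma reduce_Cons_inv:
  assumes "reduced w"
  shows "reduce_Cons a (reduce_Cons (letter_inv a) w) = w"
proof (cases w)
  case (Cons b v)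
  then show ?thesis using assms by (cases v) auto
qed auto

lemma reduce_Cons_reduced: "reduced (a # w) \<Longrightarrow> reduce_Cons a w = a # w"
  by (cases w) auto

lemma reduced_foldr: "reduced v \<Longrightarrow> reduced (foldr reduce_Cons u v)"
  by (induction u) (auto intro: reduced_reduce_Cons)

lemma set_foldr_reduce: "set (foldr reduce_Cons u v) \<subseteq> set u \<union> set v"
proof (induction u)
  case (Cons a u)
  then show ?case using set_reduce_Cons[of a "foldr reduce_Cons u v"] by auto
qed auto

lemma foldr_reduce_Nil: "reduced u \<Longrightarrow> foldr reduce_Cons u [] = u"
proof (induction u)
  case (Cons a u)
  then show ?case using reduced_ConsD[OF Cons.prems] by (simp add: reduce_Cons_reduced)
qed simp

lemma foldr_reduce_Cons:
  assumes "reduced w"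
  shows "foldr reduce_Cons (reduce_Cons a v) w = reduce_Cons a (foldr reduce_Cons v w)"
proof (cases v)
  case (Cons b v')
  then show ?thesis
    using reduce_Cons_inv[OF reduced_foldr[OF assms], of a v'] by auto
qed auto

lemma foldr_reduce_assoc:
  assumes "reduced w"
  shows "foldr reduce_Cons (foldr reduce_Cons u v) w = foldr reduce_Cons u (foldr reduce_Cons v w)"
  by (induction u) (auto simp: foldr_reduce_Cons[OF assms])

lemma foldr_reduce_rev_inv:
  assumes "reduced w"
  shows "foldr reduce_Cons (rev (map letter_inv u)) (foldr reduce_Cons u w) = w"
  using assms
proof (induction u)
  case (Cons a u)
  then show ?case
    using reduce_Cons_inv[OF reduced_foldr[OF Cons.prems], of "letter_inv a" u] by simp
qed auto

lemma group_free_group: "group (free_group k)"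
proof (rule groupI)
  fix u v assume "u \<in> carrier (free_group k)" "v \<in> carrier (free_group k)"
  then show "u \<otimes>\<^bsub>free_group k\<^esub> v \<in> carrier (free_group k)"
    using set_foldr_reduce[of u v] reduced_foldr[of v u]
    unfolding free_group_def by (simp add: image_subset_iff subset_iff) blast
next
  fix u assume u: "u \<in> carrier (free_group k)"
  define u' where "u' = foldr reduce_Cons (rev (map letter_inv u)) []"
  have "set u' \<subseteq> letter_inv ` set u"
    using set_foldr_reduce[of "rev (map letter_inv u)" "[]"] by (auto simp: u'_def)
  then have "letter_index ` set u' \<subseteq> letter_index ` set u"
    by (force simp: subset_iff)
  moreover have "reduced u'" by (simp add: u'_def reduced_foldr)
  ultimately have "u' \<in> carrier (free_group k)"
    using u by (auto simp: free_group_def)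
  moreover have "u' \<otimes>\<^bsub>free_group k\<^esub> u = \<one>\<^bsub>free_group k\<^esub>"
    using u foldr_reduce_rev_inv[of "[]" u]
    by (simp add: free_group_def u'_def foldr_reduce_assoc foldr_reduce_Nil)
  ultimately show "\<exists>u'\<in>carrier (free_group k). u' \<otimes>\<^bsub>free_group k\<^esub> u = \<one>\<^bsub>free_group k\<^esub>" by blast
qed (auto simp: free_group_def foldr_reduce_assoc)

lemma letter_eval_closed:
  assumes "group G" "letter_index a \<in> I" "g \<in> I \<rightarrow> carrier G"
  shows "letter_eval G g a \<in> carrier G"
  using assms by (cases a) (auto intro: group.inv_closed)

lemma letter_eval_inv:
  assumes "group G" "letter_index a \<in> I" "g \<in> I \<rightarrow> carrier G"
  shows "letter_eval G g (letter_inv a) = inv\<^bsub>G\<^esub> (letter_eval G g a)"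
  using assms group.inv_inv[OF assms(1)] by (cases a) (auto dest: funcset_mem)

lemma word_eval_closed:
  assumes "group G" "letter_index ` set w \<subseteq> I" "g \<in> I \<rightarrow> carrier G"
  shows "word_eval G g w \<in> carrier G"
  using assms(2)
proof (induction w)
  case Nil
  then show ?case using assms(1) by (simp add: group.is_monoid)
next
  case (Cons a w)
  then show ?case
    using letter_eval_closed[OF assms(1) _ assms(3), of a] assms(1)
    by (auto intro!: monoid.m_closed group.is_monoid)
qed

lemma word_eval_reduce_Cons:
  assumes G: "group G" and g: "g \<in> I \<rightarrow> carrier G"
    and a: "letter_index a \<in> I" and w: "letter_index ` set w \<subseteq> I"
  shows "word_eval G g (reduce_Cons a w) = letter_eval G g a \<otimes>\<^bsub>G\<^esub> word_eval G g w"
proof (cases w)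
  case (Cons b v)
  interpret group G by (rule G)
  have "letter_eval G g a \<in> carrier G" "word_eval G g v \<in> carrier G"
    using letter_eval_closed[OF G a g] word_eval_closed[OF G _ g, of v] w Cons by auto
  then show ?thesis
    using letter_eval_inv[OF G a g] Cons by (auto simp: inv_closed m_assoc[symmetric])
qed simp

lemma word_eval_hom:
  assumes G: "group G" and g: "g \<in> {1..k} \<rightarrow> carrier G"
  shows "word_eval G g \<in> hom (free_group k) G"
proof (rule homI)
  interpret group G by (rule G)
  fix u v assume uv: "u \<in> carrier (free_group k)" "v \<in> carrier (free_group k)"
  show "word_eval G g u \<in> carrier G"
    using uv word_eval_closed[OF G _ g] by (auto simp: free_group_def)
  have v: "letter_index ` set v \<subseteq> {1..k}" using uv by (simp add: free_group_def)
  have "letter_index ` set u \<subseteq> {1..k}" using uv by (simp add: free_group_def)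
  then have "word_eval G g (foldr reduce_Cons u v) = word_eval G g u \<otimes>\<^bsub>G\<^esub> word_eval G g v"
  proof (induction u)
    case Nil
    then show ?case using word_eval_closed[OF G v g] by simp
  next
    case (Cons a u)
    have "letter_index ` set (foldr reduce_Cons u v) \<subseteq> {1..k}"
      using image_mono[OF set_foldr_reduce[of u v], of letter_index] Cons.prems v
      unfolding image_Un by (simp del: atLeastAtMost_iff) (meson Un_least subset_trans)
    moreover have a: "letter_index a \<in> {1..k}" and u: "letter_index ` set u \<subseteq> {1..k}"
      using Cons.prems by auto
    ultimately show ?case
      using Cons.IH[OF u] word_eval_reduce_Cons[OF G g a] letter_eval_closed[OF G a g]
        word_eval_closed[OF G u g] word_eval_closed[OF G v g] by (simp add: m_assoc)
  qed
  then show "word_eval G g (u \<otimes>\<^bsub>free_group k\<^esub> v) = word_eval G g u \<otimes>\<^bsub>G\<^esub> word_eval G g v"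
    by (simp add: free_group_def)
qed

end

theory Submission
  imports Defs "HOL-Real_Asymp.Real_Asymp"
begin

text \<open>
  Only the first inequality has content. Reveal a random tuple \<open>g\<close> of permutations of an
  \<open>n\<close>-element set \<open>A\<close> one edge \<open>g a x = y\<close> at a time, as follows. Choose a point \<open>p\<close> that is not
  yet the head \<open>y\<close> of any revealed edge, and follow its trajectory under the letters of \<open>w\<close>. If
  \<open>w(g) = 1\<close>, the trajectory ends at \<open>p\<close>, so at some step it enters \<open>p\<close> for the first time.
  Because \<open>w\<close> is positive, edges are only ever read forwards; hence the edge entering \<open>p\<close> was not
  known before that step, and its head was uniform over the at least \<open>n - m\<close> values still
  possible, where \<open>m\<close> bounds the number of revealed edges. (With inverses, a step out of \<open>p\<close> along
  \<open>a\<^sup>-\<^sup>1\<close> would already reveal an edge entering \<open>p\<close>.) A union bound over the \<open>l\<close> steps shows that the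
  round succeeds with probability at most \<open>l / (n - m)\<close>. A round reveals at most \<open>l\<close> edges, so
  \<open>t = \<lfloor>n / (2l)\<rfloor>\<close> rounds reveal at most \<open>n / 2\<close> of them, and each has success probability at most
  \<open>2l / n\<close>, conditionally on the previous ones.

  Conditioning on a set \<open>E\<close> of revealed edges means restricting to the tuples \<open>extensions I A E\<close>
  that contain \<open>E\<close>, so the argument becomes a chain of cardinality estimates:
  \<open>card_extensions_insert\<close> is the probability of hitting a fresh point in one step,
  \<open>card_visits_le\<close> the union bound along one trajectory, and \<open>card_solutions_extending_le\<close> the
  induction over rounds.

  For the second inequality, \<open>\<epsilon> n\<close> is defined so as to make it an equality whenever \<open>n \<ge> 2\<close>; that
  \<open>\<epsilon>\<close> tends to \<open>0\<close> then follows from \<open>ln (n!) \<sim> n ln n\<close>.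
\<close>

section \<open>Permutation tuples containing prescribed edges\<close>

text \<open>
  A triple \<open>(a, x, y)\<close> is a directed edge from \<open>x\<close> to \<open>y\<close> labelled \<open>a\<close>. Contradictory edge sets are
  allowed and simply have no extensions, which spares a case distinction on whether an edge is
  already determined.
\<close>

definition extensions :: "'i set \<Rightarrow> 'a set \<Rightarrow> ('i \<times> 'a \<times> 'a) set \<Rightarrow> ('i \<Rightarrow> 'a \<Rightarrow> 'a) set" where
  "extensions I A E = {g \<in> I \<rightarrow>\<^sub>E {f. f permutes A}. \<forall>(a, x, y) \<in> E. g a x = y}"

definition edge_heads :: "('i \<times> 'a \<times> 'a) set \<Rightarrow> 'a set" where
  "edge_heads E = (\<lambda>(a, x, y). y) ` E"

lemma edge_heads_insert [simp]: "edge_heads (insert (a, x, y) E) = insert y (edge_heads E)"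
  by (simp add: edge_heads_def)

lemma finite_edge_heads: "finite E \<Longrightarrow> finite (edge_heads E)"
  by (simp add: edge_heads_def)

lemma card_edge_heads_le: "finite E \<Longrightarrow> card (edge_heads E) \<le> card E"
  by (simp add: edge_heads_def card_image_le)

lemma finite_extensions:
  assumes "finite I" "finite A"
  shows "finite (extensions I A E)"
proof -
  have "finite (I \<rightarrow>\<^sub>E {f. f permutes A})"
    using assms by (intro finite_PiE finite_permutations)
  then show ?thesis
    by (simp add: extensions_def)
qed

lemma extensions_permutes: "g \<in> extensions I A E \<Longrightarrow> a \<in> I \<Longrightarrow> g a permutes A"
  by (auto simp: extensions_def)

lemma extensions_insert:
  "extensions I A (insert (a, x, y) E) = {g \<in> extensions I A E. g a x = y}"
  by (auto simp: extensions_def)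

text \<open>
  Given the edges \<open>E\<close>, an edge from \<open>y\<close> leads to a prescribed fresh point \<open>p\<close> with probability at
  most \<open>1 / (card A - card E)\<close>. The reason is symmetry between fresh points: composing \<open>g a\<close> with
  the transposition of \<open>p\<close> and another fresh point \<open>z\<close> moves the head of that edge from \<open>p\<close> to \<open>z\<close>
  and disturbs no edge of \<open>E\<close>, and different \<open>z\<close> give disjoint sets of tuples.
\<close>

lemma card_extensions_insert:
  assumes fin: "finite I" "finite A" "finite E"
    and a: "a \<in> I" and p: "p \<in> A" "p \<notin> edge_heads E"
  shows "(card A - card E) * card (extensions I A (insert (a, y, p) E))
    \<le> card (extensions I A E)"
proof -
  define switch where
    "switch = (\<lambda>(z, g). g(a := transpose p z \<circ> g a) :: 'a \<Rightarrow> 'b \<Rightarrow> 'b)"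
  let ?F = "A - edge_heads E" and ?X = "extensions I A (insert (a, y, p) E)"
  have "inj_on switch (?F \<times> ?X)"
  proof (rule inj_onI, clarify)
    fix z g z' g'
    assume g: "g \<in> ?X" and g': "g' \<in> ?X" and eq: "switch (z, g) = switch (z', g')"
    have *: "transpose p z \<circ> g a = transpose p z' \<circ> g' a"
      using fun_cong[OF eq, of a] by (simp add: switch_def)
    \<comment> \<open>The new image of \<open>y\<close> is \<open>z\<close>, so the transposition can be undone.\<close>
    have "z = z'"
      using fun_cong[OF *, of y] g g' by (simp add: extensions_insert)
    moreover have "g a = g' a"
      using * \<open>z = z'\<close> by (metis comp_assoc transpose_comp_involutory id_comp)
    moreover have "g b = g' b" if "b \<noteq> a" for b
      using fun_cong[OF eq, of b] that by (simp add: switch_def)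
    ultimately show "z = z' \<and> g = g'" by (metis ext)
  qed
  moreover have "switch ` (?F \<times> ?X) \<subseteq> extensions I A E"
  proof clarify
    fix z g
    assume z: "z \<in> A" "z \<notin> edge_heads E" and g: "g \<in> ?X"
    have "transpose p z \<circ> g a permutes A"
      using extensions_permutes[OF g a] z p by (intro permutes_compose permutes_swap_id)
    then have "switch (z, g) \<in> I \<rightarrow>\<^sub>E {f. f permutes A}"
      using g a by (auto simp: switch_def extensions_def PiE_iff extensional_def)
    moreover have "switch (z, g) b x = v" if "(b, x, v) \<in> E" for b x v
    proof -
      have "g b x = v" using that g by (auto simp: extensions_def)
      moreover have "transpose p z v = v"
        using that z p by (intro transpose_apply_other) (force simp: edge_heads_def)+
      ultimately show ?thesis by (auto simp: switch_def)
    qed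
    ultimately show "switch (z, g) \<in> extensions I A E"
      by (auto simp: extensions_def)
  qed
  ultimately have "card ?F * card ?X \<le> card (extensions I A E)"
    using card_inj_on_le[of switch "?F \<times> ?X"] finite_extensions[OF fin(1,2)]
    by (simp add: card_cartesian_product)
  moreover have "card A - card E \<le> card ?F"
    using diff_card_le_card_Diff[OF finite_edge_heads[OF fin(3)], of A]
      card_edge_heads_le[OF fin(3)] by linarith
  ultimately show ?thesis
    by (meson le_trans mult_le_mono1)
qed

section \<open>Trajectories\<close>

text \<open>
  The starting point itself does not count as a visit: a trajectory starting at \<open>p\<close> has to return.
\<close>

primrec visits :: "('i \<Rightarrow> 'a \<Rightarrow> 'a) \<Rightarrow> 'a \<Rightarrow> 'i list \<Rightarrow> 'a \<Rightarrow> bool" where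
  "visits g p [] y = False"
| "visits g p (a # u) y = (g a y = p \<or> visits g p u (g a y))"

lemma visits_final:
  assumes "u \<noteq> []"
  shows "visits g (fold g u y) u y"
  using assms
proof (induction u arbitrary: y)
  case (Cons a u)
  then show ?case by (cases "u = []") auto
qed simp

text \<open>
  The union bound over the steps of a trajectory, with a set \<open>W\<close> of tuples whose conditional
  probability is at most \<open>c\<close> whatever edges, at most \<open>m\<close> in number, have been revealed. Keeping \<open>W\<close>
  inside the estimate is what allows rounds to be chained: as soon as \<open>p\<close> is hit, the rest of the
  trajectory is abandoned and the bound for \<open>W\<close> is applied to the edges revealed so far. Until then
  every revealed edge avoids \<open>p\<close>, so \<open>p\<close> stays fresh.
\<close>

lemma card_visits_le:
  fixes c :: real
  assumes fin: "finite I" "finite A" and m: "m < card A"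
    and p: "p \<in> A" and u: "set u \<subseteq> I" and y: "y \<in> A"
    and E: "finite E" "card E + length u \<le> m" "p \<notin> edge_heads E"
    and c: "c \<ge> 0"
    and good: "\<And>E'. finite E' \<Longrightarrow> card E' \<le> m \<Longrightarrow>
      real (card (W \<inter> extensions I A E')) \<le> c * real (card (extensions I A E'))"
  shows "real (card {g \<in> W \<inter> extensions I A E. visits g p u y})
    \<le> c * (real (length u) / real (card A - m)) * real (card (extensions I A E))"
  using u y E
proof (induction u arbitrary: y E)
  case (Cons a u)
  let ?X = "extensions I A" and ?D = "real (card A - m)"
  let ?hit = "insert (a, y, p) E" and ?step = "\<lambda>z. insert (a, y, z) E"
  let ?V = "\<lambda>z. {g \<in> W \<inter> ?X (?step z). visits g p u z}"
  note finX [simp] = finite_extensions[OF fin]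
  have D: "?D > 0" using m by simp
  have a: "a \<in> I" using Cons.prems by simp
  have card_insert: "card (insert e E) \<le> Suc (card E)" for e
    using Cons.prems by (simp add: card_insert_if)
  have image: "g a y \<in> A" if "g \<in> ?X E" for g
    using permutes_in_image[OF extensions_permutes[OF that a]] Cons.prems by simp

  \<comment> \<open>Reveal the image \<open>z\<close> of \<open>y\<close>: either it is \<open>p\<close>, or the trajectory goes on from \<open>z\<close>.\<close>
  have "{g \<in> W \<inter> ?X E. visits g p (a # u) y} \<subseteq> W \<inter> ?X ?hit \<union> (\<Union>z\<in>A - {p}. ?V z)"
    using image by (auto simp: extensions_insert)
  then have "card {g \<in> W \<inter> ?X E. visits g p (a # u) y}
      \<le> card (W \<inter> ?X ?hit \<union> (\<Union>z\<in>A - {p}. ?V z))"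
    using fin by (intro card_mono) auto
  also have "\<dots> \<le> card (W \<inter> ?X ?hit) + (\<Sum>z\<in>A - {p}. card (?V z))"
    by (intro order_trans[OF card_Un_le] add_mono card_UN_le order_refl) (use fin in auto)
  finally have "real (card {g \<in> W \<inter> ?X E. visits g p (a # u) y})
      \<le> real (card (W \<inter> ?X ?hit) + (\<Sum>z\<in>A - {p}. card (?V z)))"
    by (rule of_nat_mono)
  then have split: "real (card {g \<in> W \<inter> ?X E. visits g p (a # u) y})
      \<le> real (card (W \<inter> ?X ?hit)) + (\<Sum>z\<in>A - {p}. real (card (?V z)))"
    by (simp only: of_nat_add of_nat_sum)

  have hit: "real (card (W \<inter> ?X ?hit)) \<le> c * (1 / ?D) * real (card (?X E))"
  proof -
    have "(card A - m) * card (?X ?hit) \<le> (card A - card E) * card (?X ?hit)"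
      using Cons.prems by (intro mult_le_mono1 diff_le_mono2) simp
    also have "\<dots> \<le> card (?X E)"
      using Cons.prems fin a p by (intro card_extensions_insert) auto
    finally have "?D * real (card (?X ?hit)) \<le> real (card (?X E))"
      unfolding of_nat_mult[symmetric] by (rule of_nat_mono)
    then have *: "real (card (?X ?hit)) \<le> (1 / ?D) * real (card (?X E))"
      using D by (simp add: field_simps)
    have "real (card (W \<inter> ?X ?hit)) \<le> c * real (card (?X ?hit))"
      using card_insert[of "(a, y, p)"] Cons.prems by (intro good) auto
    also have "\<dots> \<le> c * ((1 / ?D) * real (card (?X E)))"
      using * c by (rule mult_left_mono)
    finally show ?thesis by (simp add: mult.assoc)
  qed

  have partition: "(\<Sum>z\<in>A - {p}. real (card (?X (?step z)))) \<le> real (card (?X E))"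
  proof -
    have "(\<Sum>z\<in>A - {p}. card (?X (?step z))) = card (\<Union>z\<in>A - {p}. ?X (?step z))"
      by (subst card_UN_disjoint) (use fin in \<open>auto simp: extensions_insert\<close>)
    also have "\<dots> \<le> card (?X E)"
      by (intro card_mono) (auto simp: extensions_insert)
    finally show ?thesis
      unfolding of_nat_sum[symmetric] by (rule of_nat_mono)
  qed
  let ?r = "c * (real (length u) / ?D)"
  have "(\<Sum>z\<in>A - {p}. real (card (?V z))) \<le> (\<Sum>z\<in>A - {p}. ?r * real (card (?X (?step z))))"
  proof (rule sum_mono)
    fix z assume "z \<in> A - {p}"
    then show "real (card (?V z)) \<le> ?r * real (card (?X (?step z)))"
      using Cons.prems card_insert[of "(a, y, z)"] by (intro Cons.IH) auto
  qed
  also have "\<dots> = ?r * (\<Sum>z\<in>A - {p}. real (card (?X (?step z))))"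
    by (simp add: sum_distrib_left)
  also have "\<dots> \<le> ?r * real (card (?X E))"
    using c D by (intro mult_left_mono[OF partition]) simp
  finally show ?case
    using split hit by (simp add: field_simps add_divide_distrib distrib_left distrib_right)
qed simp

section \<open>The bound on the number of solutions\<close>

text \<open>
  Each further round costs \<open>length u\<close> revealed edges and gains one factor. The fresh point of a round
  exists because fewer than \<open>card A\<close> edges, hence fewer than \<open>card A\<close> heads, have been revealed; the
  remaining rounds supply the constant \<open>c\<close> of the preceding union bound.
\<close>

lemma card_solutions_extending_le:
  assumes fin: "finite I" "finite A" and u: "set u \<subseteq> I" "u \<noteq> []"
    and m: "m < card A" and E: "finite E" "card E + length u * j \<le> m"
  shows "real (card ({g. fold g u = id} \<inter> extensions I A E))
    \<le> (real (length u) / real (card A - m)) ^ j * real (card (extensions I A E))"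
  using E
proof (induction j arbitrary: E)
  case 0
  show ?case
    by simp (intro card_mono finite_extensions fin Int_lower2)
next
  case (Suc j)
  let ?W = "{g. fold g u = id}" and ?r = "real (length u) / real (card A - m)"
  \<comment> \<open>This round may reveal only \<open>length u\<close> edges, so that \<open>j\<close> rounds can still be played within the
    budget \<open>m\<close>.\<close>
  let ?m = "card E + length u"
  have "card (edge_heads E) < card A"
    using card_edge_heads_le[OF Suc.prems(1)] Suc.prems m by simp
  then obtain p where p: "p \<in> A" "p \<notin> edge_heads E"
    by (metis card_mono finite_edge_heads[OF Suc.prems(1)] not_le subsetI)
  have m': "?m \<le> m" using Suc.prems by simp
  have "visits g p u p" if "fold g u = id" for g
    using visits_final[OF u(2), of g p] that by simp
  then have "?W \<inter> extensions I A E \<subseteq> {g \<in> ?W \<inter> extensions I A E. visits g p u p}"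
    by blast
  then have "real (card (?W \<inter> extensions I A E))
      \<le> real (card {g \<in> ?W \<inter> extensions I A E. visits g p u p})"
    using finite_extensions[OF fin] by (intro of_nat_mono card_mono) auto
  also have "\<dots> \<le> ?r ^ j * (real (length u) / real (card A - ?m)) * real (card (extensions I A E))"
    using p u m m' Suc.prems
    by (intro card_visits_le[OF fin] Suc.IH) auto
  also have "\<dots> \<le> ?r ^ j * ?r * real (card (extensions I A E))"
    using m m' by (intro mult_right_mono mult_left_mono divide_left_mono) auto
  finally show ?case by (simp only: power_Suc2)
qed

text \<open>
  Multiplication of permutations is composition, so the last letter of \<open>w\<close> acts first.
\<close>

lemma word_eval_sym_group_positive:
  assumes "positive_word w"
  shows "word_eval (sym_group n) g w = fold g (rev (map letter_index w))"
  using assms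
proof (induction w)
  case (Cons a w)
  then show ?case
    by (cases a) (auto simp: positive_word_def sym_group_def fun_eq_iff)
qed (simp add: sym_group_def id_def)

lemma word_prob_sym_group_le:
  assumes w: "letter_index ` set w \<subseteq> {1..k}" "positive_word w" "w \<noteq> []"
    and m: "length w * j \<le> m" "m < n"
  shows "word_prob (sym_group n) k w \<le> (real (length w) / real (n - m)) ^ j"
proof -
  let ?u = "rev (map letter_index w)" and ?X = "extensions {1..k} {1..n} {}"
  have X: "?X = {1..k} \<rightarrow>\<^sub>E carrier (sym_group n)"
    by (simp add: extensions_def sym_group_def)
  have order: "order (sym_group n) = fact n"
    by (simp add: order_def sym_group_def card_permutations)
  then have cardX: "real (card ?X) = real (order (sym_group n)) ^ k"
    unfolding X by (simp add: card_PiE order_def)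
  have "{g \<in> {1..k} \<rightarrow>\<^sub>E carrier (sym_group n). word_eval (sym_group n) g w = \<one>\<^bsub>sym_group n\<^esub>}
      = {g. fold g ?u = id} \<inter> ?X"
    unfolding X using word_eval_sym_group_positive[OF w(2), of n] by (auto simp: sym_group_one)
  then have "word_prob (sym_group n) k w
      = real (card ({g. fold g ?u = id} \<inter> ?X)) / real (card ?X)"
    unfolding word_prob_def cardX by simp
  also have "\<dots> \<le> (real (length w) / real (n - m)) ^ j"
    using card_solutions_extending_le[of "{1..k}" "{1..n}" ?u m "{}" j] w m
    by (simp add: divide_le_eq cardX order image_subset_iff)
  finally show ?thesis .
qed

section \<open>Comparison with powers of the group order\<close>

lemma ln_fact_bounds:
  assumes "n \<ge> 1"
  shows "real n * ln (real n) - real n \<le> ln (fact n)" "ln (fact n) \<le> real n * ln (real n)"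
proof -
  \<comment> \<open>The lower bound comes from the single term \<open>n ^ n / n!\<close> of the series for \<open>exp n\<close>.\<close>
  have "real n ^ n / fact n \<le> (\<Sum>i\<le>n. real n ^ i / fact i)"
    by (rule member_le_sum) auto
  also have "\<dots> \<le> (\<Sum>i. real n ^ i / fact i)"
    using summable_exp[of "real n"]
    by (intro sum_le_suminf) (auto simp: field_simps)
  also have "\<dots> = exp (real n)"
    by (simp add: exp_def field_simps)
  finally have "ln (real n ^ n / fact n) \<le> ln (exp (real n))"
    using assms by (subst ln_le_cancel_iff) auto
  then show "real n * ln (real n) - real n \<le> ln (fact n)"
    using assms by (simp add: ln_div ln_realpow)
  have "fact n \<le> real n ^ n"
    using of_nat_mono[OF fact_le_power[of n], where 'a = real] by simp
  then have "ln (fact n) \<le> ln (real n ^ n)"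
    using assms by (subst ln_le_cancel_iff) auto
  then show "ln (fact n) \<le> real n * ln (real n)"
    using assms by (simp add: ln_realpow)
qed

lemma ln_fact_asymp: "(\<lambda>n. ln (fact n) / (real n * ln (real n))) \<longlonglongrightarrow> 1"
proof (rule tendsto_sandwich)
  show "\<forall>\<^sub>F n in sequentially. 1 - 1 / ln (real n) \<le> ln (fact n) / (real n * ln (real n))"
    using eventually_ge_at_top[of 2]
  proof eventually_elim
    case (elim n)
    then have pos: "real n > 0" "ln (real n) > 0" by auto
    then have "1 - 1 / ln (real n) = (real n * ln (real n) - real n) / (real n * ln (real n))"
      by (simp add: diff_divide_distrib)
    also have "\<dots> \<le> ln (fact n) / (real n * ln (real n))"
      using elim pos by (intro divide_right_mono ln_fact_bounds) auto
    finally show ?case .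
  qed
  show "\<forall>\<^sub>F n in sequentially. ln (fact n) / (real n * ln (real n)) \<le> 1"
    using eventually_ge_at_top[of 2]
  proof eventually_elim
    case (elim n)
    then show ?case using ln_fact_bounds(2)[of n] by (simp add: field_simps)
  qed
  show "(\<lambda>n. 1 - 1 / ln (real n)) \<longlonglongrightarrow> 1" by real_asymp
qed simp

lemma floor_div_asymp:
  assumes "L > 0"
  shows "(\<lambda>n. real (nat \<lfloor>real n / L\<rfloor>) / real n) \<longlonglongrightarrow> 1 / L"
proof (rule tendsto_sandwich)
  have bounds: "x - 1 \<le> real (nat \<lfloor>x\<rfloor>)" "real (nat \<lfloor>x\<rfloor>) \<le> x" if "x \<ge> 0" for x :: real
    using that by linarith+
  show "\<forall>\<^sub>F n in sequentially. 1 / L - 1 / real n \<le> real (nat \<lfloor>real n / L\<rfloor>) / real n"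
    using eventually_ge_at_top[of 1]
  proof eventually_elim
    case (elim n)
    have "(real n / L - 1) / real n \<le> real (nat \<lfloor>real n / L\<rfloor>) / real n"
      using assms by (intro divide_right_mono bounds) auto
    then show ?case using elim by (simp add: diff_divide_distrib)
  qed
  show "\<forall>\<^sub>F n in sequentially. real (nat \<lfloor>real n / L\<rfloor>) / real n \<le> 1 / L"
    using eventually_ge_at_top[of 1]
  proof eventually_elim
    case (elim n)
    have "real (nat \<lfloor>real n / L\<rfloor>) / real n \<le> (real n / L) / real n"
      using assms by (intro divide_right_mono bounds) auto
    then show ?case using elim by simp
  qed
  show "(\<lambda>n. 1 / L - 1 / real n) \<longlonglongrightarrow> 1 / L" by real_asymp
qed simp

text \<open>
  The logarithm of the power is \<open>\<lfloor>n / L\<rfloor> (ln L - ln n)\<close>, which behaves like \<open>- (n ln n) / L\<close>.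
\<close>

lemma ln_power_over_ln_fact:
  assumes L: "L > 0"
  shows "(\<lambda>n. ln ((L / real n) ^ nat \<lfloor>real n / L\<rfloor>) / ln (fact n)) \<longlonglongrightarrow> - (1 / L)"
proof -
  let ?t = "\<lambda>n. real (nat \<lfloor>real n / L\<rfloor>)"
  have "(\<lambda>n. (ln L - ln (real n)) / ln (real n)) \<longlonglongrightarrow> -1"
    using L by real_asymp
  then have "(\<lambda>n. (?t n / real n) * ((ln L - ln (real n)) / ln (real n))
      / (ln (fact n) / (real n * ln (real n)))) \<longlonglongrightarrow> (1 / L) * (- 1) / 1"
    by (intro tendsto_intros floor_div_asymp ln_fact_asymp L) auto
  then show ?thesis
  proof (rule filterlim_cong[THEN iffD1, rotated -1])
    show "\<forall>\<^sub>F n in sequentially. (?t n / real n) * ((ln L - ln (real n)) / ln (real n))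
        / (ln (fact n) / (real n * ln (real n)))
        = ln ((L / real n) ^ nat \<lfloor>real n / L\<rfloor>) / ln (fact n)"
      using eventually_ge_at_top[of 2]
    proof eventually_elim
      case (elim n)
      then have nz: "ln (real n) \<noteq> 0" "real n > 0" by auto
      have "a / x * (b / s) / (f / (x * s)) = a * b / f" if "x \<noteq> 0" "s \<noteq> 0" for a b s f x :: real
        using that by (simp add: field_simps)
      then show ?case
        using L nz by (simp add: ln_realpow ln_div)
    qed
  qed auto
qed

theorem proposition5:
  fixes l :: nat
  assumes "l \<ge> 1"
  shows "\<exists>\<epsilon> :: nat \<Rightarrow> real. \<epsilon> \<longlonglongrightarrow> 0 \<and>
    (\<forall>(k::nat) w (n::nat).
       w \<in> carrier (free_group k) \<longrightarrow> positive_word w \<longrightarrow> length w = l \<longrightarrow> n \<ge> 1 \<longrightarrow>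
         word_prob (sym_group n) k w
           \<le> (2 * real l / real n) ^ nat \<lfloor>real n / (2 * real l)\<rfloor> \<and>
         (2 * real l / real n) ^ nat \<lfloor>real n / (2 * real l)\<rfloor>
           \<le> (fact n :: real) powr (- (1 / (2 * real l)) + \<epsilon> n))"
proof -
  define L where "L = 2 * real l"
  have L: "L > 0" using assms by (simp add: L_def)
  define B where "B n = (L / real n) ^ nat \<lfloor>real n / L\<rfloor>" for n
  \<comment> \<open>At \<open>n = 1\<close> the first summand is a division by \<open>ln 1 = 0\<close>; there both sides of the inequality
    are \<open>1\<close> whatever the exponent.\<close>
  define \<epsilon> where "\<epsilon> n = ln (B n) / ln (fact n) + 1 / L" for n
  have "\<epsilon> \<longlonglongrightarrow> - (1 / L) + 1 / L"
    unfolding \<epsilon>_def B_def by (intro tendsto_intros ln_power_over_ln_fact L)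
  then have lim: "\<epsilon> \<longlonglongrightarrow> 0" by simp
  have prob: "word_prob (sym_group n) k w \<le> B n"
    if w: "w \<in> carrier (free_group k)" "positive_word w" "length w = l" and n: "n \<ge> 1" for k w n
  proof -
    define t where "t = nat \<lfloor>real n / L\<rfloor>"
    \<comment> \<open>The edge budget \<open>m = l * t\<close> is at most \<open>n / 2\<close>.\<close>
    have "real t \<le> real n / L"
      using L unfolding t_def by (simp add: of_nat_nat)
    then have half: "2 * (real l * real t) \<le> real n"
      using L by (simp add: L_def field_simps)
    then have lt: "l * t < n"
      using n by (simp add: field_simps flip: of_nat_mult)
    have "word_prob (sym_group n) k w \<le> (real (length w) / real (n - l * t)) ^ t"
      using w lt assms by (intro word_prob_sym_group_le) (auto simp: free_group_def)
    also have "\<dots> \<le> B n"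
    proof -
      have "real (length w) / real (n - l * t) \<le> real l / (real n / 2)"
        using half lt n w by (intro frac_le) auto
      then have "real (length w) / real (n - l * t) \<le> L / real n"
        by (simp add: L_def mult.commute)
      then show ?thesis
        unfolding B_def t_def[symmetric] by (rule power_mono) simp
    qed
    finally show ?thesis .
  qed
  have "B n \<le> fact n powr (- (1 / L) + \<epsilon> n)" if n: "n \<ge> 1" for n
  proof (cases "n = 1")
    case True
    then have "nat \<lfloor>real n / L\<rfloor> = 0"
      using assms by (simp add: L_def)
    then show ?thesis using True by (simp add: B_def)
  next
    case False
    then have "ln (fact n :: real) \<noteq> 0" "B n > 0"
      using n L fact_mono[of 2 n, where 'a = real] by (auto simp: B_def)
    then show ?thesis by (simp add: powr_def \<epsilon>_def)
  qed
  then show ?thesis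
    using lim prob unfolding B_def L_def by blast
qed

end
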